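(* Let $T \colon H \to H$ be a unitary operator on a Hilbert space $H$ that has a countable Lebesgue component. Then $h_{\mathrm{apr}}(T) = \infty$.
   Context: Hilbert spaces are over $\mathbb{K}\in\{\mathbb{R},\mathbb{C}\}$ and need not be separable unless stated. A unitary operator $S$ on a separable Hilbert space $H_0$ has countable Lebesgue spectrum if there is an orthonormal sequence $(x_n)_{n\in\mathbb{N}}$ in $H_0$ such that for each $n$ the family $(S^kx_n)_{k\in\mathbb{Z}}$ is an orthonormal basis of the cyclic subspace $Z(x_n;S):=\overline{\operatorname{span}}\{S^kx_n:k\in\mathbb{Z}\}$, and $H_0=\bigoplus_{n=1}^\infty Z(x_n;S)$ (orthogonal Hilbert direct sum over infinitely many indices). A unitary operator $T$ on a Hilbert space $H$ has a countable Lebesgue component if there is a closed separable subspace $H_0\subseteq H$ with $TH_0=H_0$ such that $T|_{H_0}$ has countable Lebesgue spectrum. Approximation entropy. For a finite set $\omega\subseteq H$ and $\delta>0$ let $H_{\mathrm{apr}}(\omega,\delta)$ be the minimum of $\dim E$ over all finite-dimensional subspaces $E\subseteq H$ such that for every $x\in\omega$ there is $y\in E$ with $\lVert x-y\rVert<\delta$. Put $h_{\mathrm{apr}}(T,\omega,\delta):=\lim_{n\to\infty}\frac1n H_{\mathrm{apr}}\bigl(\bigcup_{k=0}^{n-1}T^k\omega,\delta\bigr)$ (the limit exists), $h_{\mathrm{apr}}(T,\omega):=\sup_{\delta>0}h_{\mathrm{apr}}(T,\omega,\delta)$, and $h_{\mathrm{apr}}(T):=\sup\{h_{\mathrm{apr}}(T,\omega):\omega\subseteq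 H\text{ finite}\}$. *)

theory Defs
  imports "HOL-Analysis.Analysis"
begin

text \<open>
  The class of scalar fields \<open>\<K> \<in> {\<real>, \<complex>}\<close>.  The axioms leave no other field up to isomorphism:
  see \<open>real_or_complex_cases\<close> and \<open>kcnj_unique\<close>.
\<close>

class real_or_complex_field = real_normed_field +
  fixes kcnj :: "'a \<Rightarrow> 'a"
  assumes kcnj_add: "kcnj (x + y) = kcnj x + kcnj y"
    and kcnj_mult: "kcnj (x * y) = kcnj x * kcnj y"
    and kcnj_kcnj: "kcnj (kcnj x) = x"
    and kcnj_scaleR_one: "kcnj (r *\<^sub>R 1) = r *\<^sub>R 1"
    and add_kcnj_scaleR: "\<exists>r. x + kcnj x = r *\<^sub>R 1"
    and mult_kcnj_scaleR: "x * kcnj x = (norm x)\<^sup>2 *\<^sub>R 1"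

instantiation real :: real_or_complex_field
begin

definition kcnj_real :: "real \<Rightarrow> real" where
  "kcnj_real x = x"

instance
  by standard (auto simp: kcnj_real_def power2_eq_square)

end

instantiation complex :: real_or_complex_field
begin

definition kcnj_complex :: "complex \<Rightarrow> complex" where
  "kcnj_complex = cnj"

instance
proof
  fix x y :: complex and r :: real
  show "kcnj (x + y) = kcnj x + kcnj y" "kcnj (x * y) = kcnj x * kcnj y" "kcnj (kcnj x) = x"
    "kcnj (r *\<^sub>R 1 :: complex) = r *\<^sub>R 1"
    by (simp_all add: kcnj_complex_def)
  show "\<exists>r. x + kcnj x = r *\<^sub>R 1"
    unfolding kcnj_complex_def complex_add_cnj scaleR_conv_of_real by (rule exI[of _ "2 * Re x"]) simp
  show "x * kcnj x = (norm x)\<^sup>2 *\<^sub>R 1"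
    unfolding kcnj_complex_def complex_norm_square[symmetric] scaleR_conv_of_real by simp
qed

end

lemma kcnj_of_real: "kcnj (of_real r) = (of_real r :: 'k::real_or_complex_field)"
  by (simp add: of_real_def kcnj_scaleR_one)

lemma add_kcnj: "(x :: 'k::real_or_complex_field) + kcnj x \<in> \<real>"
  using add_kcnj_scaleR[of x] by (auto simp: Reals_def of_real_def)

lemma mult_kcnj: "(x :: 'k::real_or_complex_field) * kcnj x = of_real ((norm x)\<^sup>2)"
  by (simp add: of_real_def mult_kcnj_scaleR)

lemma real_or_complex_shift:
  fixes x :: "'k::real_or_complex_field"
  obtains a s :: real where "(x - of_real a)\<^sup>2 = of_real s"
proof -
  obtain r where r: "x + kcnj x = of_real r"
    using add_kcnj[of x] by (auto elim: Reals_cases)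
  define n where "n = (norm x)\<^sup>2"
  have c: "kcnj x = of_real r - x"
    using r by (simp add: algebra_simps)
  have "x * (of_real r - x) = of_real n"
    using mult_kcnj[of x] c unfolding n_def by simp
  then have "x * x = of_real r * x - of_real n"
    by (simp add: algebra_simps)
  moreover have "of_real r = (of_real (r / 2) + of_real (r / 2) :: 'k)"
    by (simp only: of_real_add[symmetric] field_sum_of_halves)
  ultimately have "x * x = (of_real (r / 2) + of_real (r / 2)) * x - of_real n"
    by metis
  then have "(x - of_real (r / 2))\<^sup>2 = of_real ((r / 2)\<^sup>2 - n)"
    by (simp only: power2_eq_square algebra_simps of_real_diff of_real_mult) simp
  then show thesis by (rule that)
qed

lemma real_or_complex_nonneg_square:
  fixes y :: "'k::real_or_complex_field"
  assumes "y\<^sup>2 = of_real s" "0 \<le> s"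
  shows "y \<in> \<real>"
proof -
  have "y\<^sup>2 = (of_real (sqrt s))\<^sup>2"
    using assms by (simp flip: of_real_power)
  then show ?thesis
    by (auto simp: power2_eq_iff)
qed

lemma real_or_complex_neg_square:
  fixes y :: "'k::real_or_complex_field"
  assumes "y\<^sup>2 = of_real s" "s < 0"
  obtains i where "i\<^sup>2 = -1" "y = of_real (sqrt (- s)) * i"
proof
  have *: "of_real (sqrt (- s)) \<noteq> (0::'k)" using assms by simp
  show "(y / of_real (sqrt (- s)))\<^sup>2 = -1"
    using assms * by (simp add: power_divide flip: of_real_power)
  show "y = of_real (sqrt (- s)) * (y / of_real (sqrt (- s)))"
    using * by simp
qed

lemma real_or_complex_cases:
  "(\<forall>x::'k::real_or_complex_field. x \<in> \<real>) \<or>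
   (\<exists>i::'k. i\<^sup>2 = -1 \<and> (\<forall>x. \<exists>a b. x = of_real a + of_real b * i))"
proof (cases "\<forall>x::'k. x \<in> \<real>")
  case False
  then obtain x :: 'k where x: "x \<notin> \<real>" by blast
  obtain a s where a: "(x - of_real a)\<^sup>2 = of_real s"
    by (rule real_or_complex_shift)
  have "s < 0"
  proof (rule ccontr)
    assume "\<not> s < 0"
    then have "x - of_real a \<in> \<real>"
      using a real_or_complex_nonneg_square by force
    then have "x - of_real a + of_real a \<in> \<real>"
      by (intro Reals_add) auto
    then show False using x by simp
  qed
  with a obtain i :: 'k where i: "i\<^sup>2 = -1"
    by (rule real_or_complex_neg_square)
  have "\<exists>b c. y = of_real b + of_real c * i" for y :: 'k
  proof -
    obtain b t where b: "(y - of_real b)\<^sup>2 = of_real t"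
      by (rule real_or_complex_shift)
    show ?thesis
    proof (cases "0 \<le> t")
      case True
      then obtain c where "y - of_real b = of_real c"
        using b real_or_complex_nonneg_square by (metis Reals_cases)
      then have "y = of_real (b + c) + of_real 0 * i"
        by (simp add: algebra_simps)
      then show ?thesis by blast
    next
      case False
      then have "t < 0" by simp
      with b obtain j where j: "j\<^sup>2 = -1" "y - of_real b = of_real (sqrt (- t)) * j"
        by (rule real_or_complex_neg_square)
      then have "j = i \<or> j = - i"
        using i by (metis power2_eq_iff)
      then have "y = of_real b + of_real (sqrt (- t)) * i
          \<or> y = of_real b + of_real (- sqrt (- t)) * i"
        using j(2) by (auto simp: algebra_simps)
      then show ?thesis by blast
    qed
  qed
  then show ?thesis using i by blast
qed blast

lemma kcnj_unique:
  fixes i :: "'k::real_or_complex_field"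
  assumes "i\<^sup>2 = -1"
  shows "kcnj (of_real a + of_real b * i) = of_real a - of_real b * i"
    and "(norm (of_real a + of_real b * i))\<^sup>2 = a\<^sup>2 + b\<^sup>2"
proof -
  have "(norm i)\<^sup>2 = 1"
    by (metis assms norm_minus_cancel norm_one norm_power)
  then have "i * kcnj i = 1"
    using mult_kcnj[of i] by simp
  moreover have "i * (- i) = 1"
    using assms by (simp add: power2_eq_square)
  ultimately have "kcnj i = - i"
    by (metis mult_left_cancel mult_zero_left zero_neq_one)
  then show *: "kcnj (of_real a + of_real b * i) = of_real a - of_real b * i"
    by (simp add: kcnj_add kcnj_mult kcnj_of_real)
  have "(of_real ((norm (of_real a + of_real b * i))\<^sup>2) :: 'k)
      = (of_real a + of_real b * i) * (of_real a - of_real b * i)"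
    by (simp only: * flip: mult_kcnj)
  also have "\<dots> = of_real (a\<^sup>2) - of_real (b\<^sup>2) * i\<^sup>2"
    by (simp add: algebra_simps power2_eq_square)
  also have "\<dots> = of_real (a\<^sup>2 + b\<^sup>2)"
    using assms by simp
  finally show "(norm (of_real a + of_real b * i))\<^sup>2 = a\<^sup>2 + b\<^sup>2"
    by (simp only: of_real_eq_iff)
qed

text \<open>
  Completeness, the norm and the topology of the Hilbert space come from the class
  \<^class>\<open>banach\<close> of the type of vectors; the locale adds the \<open>\<K>\<close>-linear structure and the
  inner product, which is linear in its first argument.
\<close>

locale hilbert_space = V: vector_space scale
  for scale :: "'k::real_or_complex_field \<Rightarrow> 'a::banach \<Rightarrow> 'a" +
  fixes ip :: "'a \<Rightarrow> 'a \<Rightarrow> 'k"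
  assumes scale_of_real: "scale (of_real r) x = r *\<^sub>R x"
    and ip_add_left: "ip (x + y) z = ip x z + ip y z"
    and ip_scale_left: "ip (scale c x) y = c * ip x y"
    and ip_commute: "ip x y = kcnj (ip y x)"
    and ip_self: "ip x x = of_real ((norm x)\<^sup>2)"

lemma hilbert_space_real:
  "hilbert_space (*\<^sub>R) (inner :: 'a::{real_inner, banach} \<Rightarrow> 'a \<Rightarrow> real)"
  by unfold_locales
    (auto simp: algebra_simps inner_commute kcnj_real_def power2_norm_eq_inner)

lemma hilbert_space_complex:
  "hilbert_space (*) (\<lambda>x y :: complex. x * cnj y)"
  by unfold_locales
    (auto simp: algebra_simps scaleR_conv_of_real kcnj_complex_def complex_norm_square
      simp del: of_real_power)

context hilbert_space
begin

definition unitary_op :: "('a \<Rightarrow> 'a) \<Rightarrow> bool" where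
  "unitary_op T \<longleftrightarrow>
     Vector_Spaces.linear scale scale T \<and> (\<forall>x y. ip (T x) (T y) = ip x y) \<and> surj T"

definition orthonormal_family :: "('i \<Rightarrow> 'a) \<Rightarrow> bool" where
  "orthonormal_family e \<longleftrightarrow> (\<forall>i j. ip (e i) (e j) = (if i = j then 1 else 0))"

definition orthonormal_basis_of :: "('i \<Rightarrow> 'a) \<Rightarrow> 'a set \<Rightarrow> bool" where
  "orthonormal_basis_of e Z \<longleftrightarrow> orthonormal_family e \<and> closure (V.span (range e)) = Z"

text \<open>
  \<open>int_iter H\<^sub>0 S k\<close> is the \<open>k\<close>-th power, \<open>k \<in> \<int>\<close>, of the restriction of \<open>S\<close> to \<open>H\<^sub>0\<close>;
  it is meaningful on \<open>H\<^sub>0\<close> if \<open>S\<close> maps \<open>H\<^sub>0\<close> bijectively onto itself.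
\<close>

definition int_iter :: "'a set \<Rightarrow> ('a \<Rightarrow> 'a) \<Rightarrow> int \<Rightarrow> 'a \<Rightarrow> 'a" where
  "int_iter H\<^sub>0 S k =
     (if 0 \<le> k then S ^^ nat k else inv_into H\<^sub>0 S ^^ nat (- k))"

definition cyclic_subspace :: "'a set \<Rightarrow> ('a \<Rightarrow> 'a) \<Rightarrow> 'a \<Rightarrow> 'a set" where
  "cyclic_subspace H\<^sub>0 S x = closure (V.span (range (\<lambda>k::int. int_iter H\<^sub>0 S k x)))"

definition hilbert_direct_sum :: "'a set \<Rightarrow> (nat \<Rightarrow> 'a set) \<Rightarrow> bool" where
  "hilbert_direct_sum H\<^sub>0 Z \<longleftrightarrow>
     (\<forall>n. V.subspace (Z n) \<and> closed (Z n)) \<and>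
     (\<forall>m n. m \<noteq> n \<longrightarrow> (\<forall>x\<in>Z m. \<forall>y\<in>Z n. ip x y = 0)) \<and>
     closure (V.span (\<Union>n. Z n)) = H\<^sub>0"

text \<open>The operator is the restriction of \<open>S\<close> to the closed separable subspace \<open>H\<^sub>0\<close>.\<close>

definition countable_lebesgue_spectrum :: "'a set \<Rightarrow> ('a \<Rightarrow> 'a) \<Rightarrow> bool" where
  "countable_lebesgue_spectrum H\<^sub>0 S \<longleftrightarrow>
     (\<exists>x :: nat \<Rightarrow> 'a.
        range x \<subseteq> H\<^sub>0 \<and> orthonormal_family x \<and>
        (\<forall>n. orthonormal_basis_of (\<lambda>k::int. int_iter H\<^sub>0 S k (x n))
               (cyclic_subspace H\<^sub>0 S (x n))) \<and>
        hilbert_direct_sum H\<^sub>0 (\<lambda>n. cyclic_subspace H\<^sub>0 S (x n)))"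

definition has_countable_lebesgue_component :: "('a \<Rightarrow> 'a) \<Rightarrow> bool" where
  "has_countable_lebesgue_component T \<longleftrightarrow>
     (\<exists>H\<^sub>0. V.subspace H\<^sub>0 \<and> closed H\<^sub>0 \<and> separable_space (top_of_set H\<^sub>0) \<and>
        T ` H\<^sub>0 = H\<^sub>0 \<and> countable_lebesgue_spectrum H\<^sub>0 T)"

text \<open>
  \<open>V.dim\<close> is \<open>0\<close> on infinite-dimensional subspaces, hence the separate condition of finite
  dimensionality.
\<close>

definition H_apr :: "'a set \<Rightarrow> real \<Rightarrow> nat" where
  "H_apr \<omega> \<delta> = (LEAST d. \<exists>E.
     V.subspace E \<and> (\<exists>B. finite B \<and> V.span B = E) \<and> V.dim E = d \<and>
     (\<forall>x\<in>\<omega>. \<exists>y\<in>E. norm (x - y) < \<delta>))"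

text \<open>The sequence below is subadditive before division by \<open>n\<close>, so that the limit exists.\<close>

definition h_apr_delta :: "('a \<Rightarrow> 'a) \<Rightarrow> 'a set \<Rightarrow> real \<Rightarrow> real" where
  "h_apr_delta T \<omega> \<delta> = lim (\<lambda>n. real (H_apr (\<Union>k<n. (T ^^ k) ` \<omega>) \<delta>) / real n)"

definition h_apr_set :: "('a \<Rightarrow> 'a) \<Rightarrow> 'a set \<Rightarrow> ereal" where
  "h_apr_set T \<omega> = (SUP \<delta>\<in>{0<..}. ereal (h_apr_delta T \<omega> \<delta>))"

definition h_apr :: "('a \<Rightarrow> 'a) \<Rightarrow> ereal" where
  "h_apr T = (SUP \<omega>\<in>{\<omega>. finite \<omega>}. h_apr_set T \<omega>)"

end

end

theory Submission
  imports Defs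
begin

text \<open>
  If the subspace \<open>E\<close> has an orthonormal basis \<open>F\<close>, then an orthonormal system \<open>A\<close> whose members
  lie within \<open>\<delta>\<close> of \<open>E\<close> satisfies \<open>1 - \<delta>\<^sup>2 \<le> (\<Sum>f\<in>F. \<bar>\<langle>a, f\<rangle>\<bar>\<^sup>2)\<close> for all \<open>a \<in> A\<close>.  Summing over \<open>A\<close>
  and using Bessel's inequality for each \<open>f\<close> gives \<open>(1 - \<delta>\<^sup>2) \<cdot> card A \<le> dim E\<close>.  The first \<open>N\<close> generators
  of a countable Lebesgue component have \<open>n \<cdot> N\<close> orthonormal iterates under \<open>T\<^sup>0, \<dots>, T\<^sup>n\<^sup>-\<^sup>1\<close>, so they have
  entropy at least \<open>(1 - \<delta>\<^sup>2) \<cdot> N\<close>, for every \<open>N\<close>.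
\<close>

section \<open>Subadditive sequences\<close>

lemma subadditive_le_div:
  fixes a :: "nat \<Rightarrow> nat"
  assumes sub: "\<And>m n. a (m + n) \<le> a m + a n"
  shows "a (q * m + r) \<le> q * a m + a r"
proof (induction q)
  case (Suc q)
  have "a (Suc q * m + r) \<le> a m + a (q * m + r)"
    using sub[of m "q * m + r"] by (simp add: algebra_simps)
  then show ?case using Suc by simp
qed simp

text \<open>Fekete's argument: the quotients converge to their infimum. Convergence has to be
  established because \<open>lim\<close> in \<open>h_apr_delta\<close> is total and obeys limit
  bounds only for convergent sequences.\<close>

lemma fekete_nat:
  fixes a :: "nat \<Rightarrow> nat"
  assumes sub: "\<And>m n. a (m + n) \<le> a m + a n"
  shows "convergent (\<lambda>n. real (a n) / real n)"
proof -
  define L where "L = (INF n\<in>{1..}. real (a n) / real n)"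
  have bdd: "bdd_below ((\<lambda>n. real (a n) / real n) ` {1..})"
    by (rule bdd_belowI[of _ 0]) auto
  have lower: "L \<le> real (a n) / real n" if "n \<ge> 1" for n
    unfolding L_def using bdd that by (intro cINF_lower) auto
  have "(\<lambda>n. real (a n) / real n) \<longlonglongrightarrow> L"
  proof (rule LIMSEQ_I)
    fix e :: real assume e: "0 < e"
    \<comment> \<open>Fix a block length \<open>m\<close> whose quotient nearly attains the infimum;
      a long range is cut into blocks of this length and one remainder.\<close>
    have "\<exists>m\<in>{1..}. real (a m) / real m < L + e / 2"
      using e cINF_less_iff[OF _ bdd, of "L + e / 2"] unfolding L_def by auto
    then obtain m where m: "m \<ge> 1" "real (a m) / real m < L + e / 2" by auto
    \<comment> \<open>\<open>C\<close> bounds \<open>a\<close> at every possible remainder modulo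
      \<open>m\<close>, independently of \<open>n\<close>, so its contribution vanishes after
      division by \<open>n\<close>.\<close>
    define C where "C = (\<Sum>r<m. a r)"
    obtain n0 where n0: "2 * real C / e < real n0"
      using reals_Archimedean2 by blast
    have "norm (real (a n) / real n - L) < e" if n: "n \<ge> Suc n0" for n
    proof -
      have "a n \<le> (n div m) * a m + a (n mod m)"
        using subadditive_le_div[of a "n div m" m "n mod m"] sub by simp
      moreover have "a (n mod m) \<le> C"
        unfolding C_def using m by (intro member_le_sum) auto
      ultimately have "a n \<le> (n div m) * a m + C" by linarith
      then have "real (a n) \<le> real (n div m) * real (a m) + real C"
        by (simp flip: of_nat_mult of_nat_add)
      also have "real (n div m) * real (a m) \<le> (real n / real m) * real (a m)"
        by (intro mult_right_mono of_nat_div_le_of_nat) auto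
      finally have "real (a n) / real n \<le> real (a m) / real m + real C / real n"
        using n m by (simp add: field_simps)
      moreover have "real C / real n < e / 2"
      proof -
        have "2 * real C / e < real n" using n0 n by simp
        then show ?thesis using e n by (simp add: field_simps)
      qed
      moreover have "L \<le> real (a n) / real n" using lower n by simp
      ultimately show ?thesis using m(2) unfolding real_norm_def by linarith
    qed
    then show "\<exists>no. \<forall>n\<ge>no. norm (real (a n) / real n - L) < e" by blast
  qed
  then show ?thesis by (auto simp: convergent_def)
qed

section \<open>Inner product geometry of finite orthonormal sets\<close>

context hilbert_space
begin

definition orthonormal_set :: "'a set \<Rightarrow> bool" where
  "orthonormal_set F \<longleftrightarrow> (\<forall>u\<in>F. \<forall>v\<in>F. ip u v = (if u = v then 1 else 0))"

lemma kcnj_0: "kcnj (0::'k) = 0"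
  using kcnj_of_real[of 0, where 'k='k] by simp

lemma ip_zero_left: "ip 0 z = 0"
  using ip_add_left[of 0 0 z] by simp

lemma ip_diff_left: "ip (x - y) z = ip x z - ip y z"
  using ip_add_left[of "x - y" y z] by simp

lemma ip_sum_left: "ip (\<Sum>i\<in>I. g i) z = (\<Sum>i\<in>I. ip (g i) z)"
  by (induction I rule: infinite_finite_induct) (auto simp: ip_zero_left ip_add_left)

lemma ip_eq_zero_commute: "ip x y = 0 \<longleftrightarrow> ip y x = 0"
  using ip_commute kcnj_0 by metis

lemma orthogonal_span:
  assumes "\<And>f. f \<in> F \<Longrightarrow> ip x f = 0" "y \<in> V.span F"
  shows "ip x y = 0"
proof -
  \<comment> \<open>The arguments are swapped since \<open>ip\<close> is linear in the first one,
    where span induction can act.\<close>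
  have "ip y x = 0"
    using assms(2)
  proof (induction rule: V.span_induct_alt)
    case (step c u v)
    then show ?case
      using assms(1)[of u] ip_eq_zero_commute[of u x] by (simp add: ip_add_left ip_scale_left)
  qed (simp add: ip_zero_left)
  then show ?thesis using ip_eq_zero_commute by blast
qed

lemma norm_add_orthogonal:
  assumes "ip u v = 0"
  shows "(norm (u + v))\<^sup>2 = (norm u)\<^sup>2 + (norm v)\<^sup>2"
proof -
  have "ip (u + v) (u + v) = ip u (u + v) + ip v (u + v)" by (rule ip_add_left)
  also have "ip u (u + v) = kcnj (ip u u + ip v u)"
    using ip_commute[of u "u + v"] by (simp add: ip_add_left)
  also have "\<dots> = ip u u"
    using assms ip_commute[of u u] ip_eq_zero_commute[of u v] by simp
  also have "ip v (u + v) = kcnj (ip u v + ip v v)"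
    using ip_commute[of v "u + v"] by (simp add: ip_add_left)
  also have "\<dots> = ip v v"
    using assms ip_commute[of v v] by simp
  finally show ?thesis
    unfolding ip_self by (simp only: of_real_add[symmetric] of_real_eq_iff)
qed

text \<open>For finite orthonormal \<open>F\<close> this is the orthogonal projection onto the span
  of \<open>F\<close>.\<close>

definition orth_proj :: "'a set \<Rightarrow> 'a \<Rightarrow> 'a" where
  "orth_proj F x = (\<Sum>f\<in>F. scale (ip x f) f)"

lemma orth_proj_in_span: "orth_proj F x \<in> V.span F"
  unfolding orth_proj_def by (intro V.span_sum V.span_scale V.span_base)

lemma diff_orth_proj_orthogonal:
  assumes "finite F" "orthonormal_set F" "y \<in> V.span F"
  shows "ip (x - orth_proj F x) y = 0"
proof (rule orthogonal_span[OF _ assms(3)])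
  fix f assume f: "f \<in> F"
  have "ip (orth_proj F x) f = (\<Sum>g\<in>F. ip x g * ip g f)"
    by (simp add: orth_proj_def ip_sum_left ip_scale_left)
  also have "\<dots> = (\<Sum>g\<in>F. if g = f then ip x g else 0)"
    using assms(2) f by (intro sum.cong) (auto simp: orthonormal_set_def)
  also have "\<dots> = ip x f" using assms(1) f by simp
  finally show "ip (x - orth_proj F x) f = 0" by (simp add: ip_diff_left)
qed

lemma norm_orth_proj:
  assumes "finite F" "orthonormal_set F"
  shows "(norm (orth_proj F x))\<^sup>2 = (\<Sum>f\<in>F. (norm (ip x f))\<^sup>2)"
proof -
  let ?p = "orth_proj F x"
  have "ip (x - ?p) ?p = 0"
    using assms orth_proj_in_span by (rule diff_orth_proj_orthogonal)
  then have "ip x ?p = ip ?p ?p" by (simp add: ip_diff_left)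
  \<comment> \<open>Conjugation moves the projection into the first slot, where its defining sum can
    be expanded.\<close>
  then have "ip ?p ?p = ip ?p x" using ip_commute by metis
  also have "\<dots> = (\<Sum>f\<in>F. ip x f * kcnj (ip x f))"
    by (simp add: orth_proj_def ip_sum_left ip_scale_left flip: ip_commute)
  also have "\<dots> = of_real (\<Sum>f\<in>F. (norm (ip x f))\<^sup>2)"
    by (simp only: mult_kcnj of_real_sum)
  finally show ?thesis unfolding ip_self by (simp only: of_real_eq_iff)
qed

text \<open>Pythagoras twice, with \<open>p\<close> the projection of \<open>x\<close>: the squared
  norm of \<open>x\<close> splits into those of \<open>x - p\<close> and \<open>p\<close>, and the
  first part is at most that of \<open>x - y\<close>, which splits into those of
  \<open>x - p\<close> and \<open>p - y\<close>.\<close>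

lemma norm_diff_span_ge:
  assumes "finite F" "orthonormal_set F" "y \<in> V.span F"
  shows "(norm x)\<^sup>2 \<le> (norm (x - y))\<^sup>2 + (\<Sum>f\<in>F. (norm (ip x f))\<^sup>2)"
proof -
  let ?p = "orth_proj F x"
  have "(norm ((x - ?p) + ?p))\<^sup>2 = (norm (x - ?p))\<^sup>2 + (norm ?p)\<^sup>2"
    by (intro norm_add_orthogonal diff_orth_proj_orthogonal assms orth_proj_in_span)
  moreover have "(norm ((x - ?p) + (?p - y)))\<^sup>2 = (norm (x - ?p))\<^sup>2 + (norm (?p - y))\<^sup>2"
    by (intro norm_add_orthogonal diff_orth_proj_orthogonal assms V.span_diff orth_proj_in_span)
  ultimately show ?thesis
    by (simp add: norm_orth_proj[OF assms(1,2)])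
qed

lemma bessel:
  assumes "finite F" "orthonormal_set F"
  shows "(\<Sum>f\<in>F. (norm (ip x f))\<^sup>2) \<le> (norm x)\<^sup>2"
proof -
  let ?p = "orth_proj F x"
  have "(norm ((x - ?p) + ?p))\<^sup>2 = (norm (x - ?p))\<^sup>2 + (norm ?p)\<^sup>2"
    by (intro norm_add_orthogonal diff_orth_proj_orthogonal assms orth_proj_in_span)
  then show ?thesis by (simp add: norm_orth_proj[OF assms])
qed

text \<open>The product of \<open>z\<close> and \<open>kcnj z\<close> is symmetric in the two and
  equals either squared norm.\<close>

lemma norm_kcnj: "norm (kcnj (z::'k)) = norm z"
proof -
  have "(of_real ((norm z)\<^sup>2) :: 'k) = of_real ((norm (kcnj z))\<^sup>2)"
    using mult_kcnj[of z] mult_kcnj[of "kcnj z"] by (simp only: kcnj_kcnj mult.commute)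
  then show ?thesis by (simp only: of_real_eq_iff) simp
qed

lemma norm_ip_commute: "norm (ip x y) = norm (ip y x)"
  using ip_commute norm_kcnj by metis

lemma norm_orthonormal:
  assumes "orthonormal_set F" "f \<in> F"
  shows "norm f = 1"
proof -
  have "(of_real ((norm f)\<^sup>2) :: 'k) = of_real 1"
    using assms ip_self[of f] by (simp add: orthonormal_set_def)
  then have "(norm f)\<^sup>2 = 1" by (simp only: of_real_eq_iff)
  then show ?thesis using norm_ge_zero[of f] by (auto simp: power2_eq_1_iff)
qed

text \<open>The set \<open>B\<close> may be dependent: a vector already in the span of the previous
  ones adds nothing to \<open>F\<close>, hence only an inequality of cardinalities.\<close>

lemma gram_schmidt:
  assumes "finite B"
  obtains F where "finite F" "orthonormal_set F" "card F \<le> card B" "V.span B \<subseteq> V.span F"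
  using assms
proof (induction B arbitrary: thesis rule: finite_induct)
  case empty
  then show ?case by (auto simp: orthonormal_set_def)
next
  case (insert b B)
  obtain F where F: "finite F" "orthonormal_set F" "card F \<le> card B" "V.span B \<subseteq> V.span F"
    using insert.IH by blast
  \<comment> \<open>The component of \<open>b\<close> orthogonal to \<open>F\<close>; normalised, it
    is the next member of the orthonormal set.\<close>
  define c where "c = b - orth_proj F b"
  show ?case
  proof (cases "c = 0")
    case True
    then have "b \<in> V.span F" using orth_proj_in_span[of F b] by (simp add: c_def)
    moreover have "B \<subseteq> V.span F" using F(4) V.span_superset by blast
    ultimately have "V.span (insert b B) \<subseteq> V.span F"
      by (intro V.span_minimal V.subspace_span) auto
    then show ?thesis using F insert.hyps by (intro insert.prems[of F]) auto
  next
    case False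
    define u where "u = scale (of_real (1 / norm c)) c"
    have nu: "norm u = 1" using False by (simp add: u_def scale_of_real del: of_real_divide)
    have cu: "c = scale (of_real (norm c)) u"
      using False by (simp add: u_def scale_of_real del: of_real_divide)
    have u_orth: "ip u f = 0" if "f \<in> F" for f
      using diff_orth_proj_orthogonal[OF F(1,2) V.span_base[OF that], of b]
      by (simp add: u_def ip_scale_left flip: c_def)
    have ortho: "orthonormal_set (insert u F)"
      using F(2) u_orth ip_eq_zero_commute nu ip_self[of u]
      by (auto simp: orthonormal_set_def)
    have sub: "V.span F \<subseteq> V.span (insert u F)" by (intro V.span_mono) auto
    have "c \<in> V.span (insert u F)"
      by (subst cu) (intro V.span_scale V.span_base, simp)
    then have "c + orth_proj F b \<in> V.span (insert u F)"
      using sub orth_proj_in_span by (intro V.span_add) auto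
    then have "b \<in> V.span (insert u F)" by (simp add: c_def)
    moreover have "B \<subseteq> V.span (insert u F)" using F(4) V.span_superset sub by blast
    ultimately have "V.span (insert b B) \<subseteq> V.span (insert u F)"
      by (intro V.span_minimal V.subspace_span) auto
    moreover have "card (insert u F) \<le> card (insert b B)"
      using F insert.hyps by (simp add: card_insert_if)
    ultimately show ?thesis using F ortho by (intro insert.prems[of "insert u F"]) auto
  qed
qed

lemma card_orthonormal_approx:
  assumes "finite A" "orthonormal_set A" "finite B" "0 < \<delta>"
    and approx: "\<And>a. a \<in> A \<Longrightarrow> \<exists>y\<in>V.span B. norm (a - y) < \<delta>"
  shows "(1 - \<delta>\<^sup>2) * real (card A) \<le> real (card B)"
proof -
  obtain F where F: "finite F" "orthonormal_set F" "card F \<le> card B" "V.span B \<subseteq> V.span F"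
    using gram_schmidt[OF assms(3)] .
  have "1 - \<delta>\<^sup>2 \<le> (\<Sum>f\<in>F. (norm (ip a f))\<^sup>2)" if a: "a \<in> A" for a
  proof -
    obtain y where y: "y \<in> V.span F" "norm (a - y) < \<delta>"
      using approx[OF a] F(4) by blast
    have "(norm (a - y))\<^sup>2 \<le> \<delta>\<^sup>2" using y by (intro power_mono) auto
    then show ?thesis
      using norm_diff_span_ge[OF F(1,2) y(1), of a] norm_orthonormal[OF assms(2) a] by simp
  qed
  then have "(\<Sum>a\<in>A. 1 - \<delta>\<^sup>2) \<le> (\<Sum>a\<in>A. \<Sum>f\<in>F. (norm (ip a f))\<^sup>2)"
    by (rule sum_mono)
  \<comment> \<open>Exchanging the sums and the arguments of \<open>ip\<close> turns the roles
    around: Bessel now applies to each \<open>f\<close> against the orthonormal set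
    \<open>A\<close>.\<close>
  also have "\<dots> = (\<Sum>f\<in>F. \<Sum>a\<in>A. (norm (ip f a))\<^sup>2)"
    by (subst sum.swap) (simp add: norm_ip_commute)
  also have "\<dots> \<le> (\<Sum>f\<in>F. (norm f)\<^sup>2)"
    by (intro sum_mono bessel assms)
  also have "\<dots> = real (card F)"
    using norm_orthonormal[OF F(2)] by simp
  also have "\<dots> \<le> real (card B)" using F(3) by simp
  finally show ?thesis by (simp add: mult.commute)
qed

section \<open>Approximation numbers of finite sets\<close>

lemma H_apr_le:
  assumes "finite B" "\<And>x. x \<in> \<omega> \<Longrightarrow> \<exists>y\<in>V.span B. norm (x - y) < \<delta>"
  shows "H_apr \<omega> \<delta> \<le> card B"
proof -
  have "H_apr \<omega> \<delta> \<le> V.dim (V.span B)"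
    unfolding H_apr_def using assms
    by (intro Least_le exI[of _ "V.span B"]) (auto intro: V.subspace_span)
  also have "\<dots> \<le> card B"
    using assms(1) by (intro V.dim_le_card) auto
  finally show ?thesis .
qed

lemma H_apr_witness:
  assumes "finite \<omega>" "0 < \<delta>"
  obtains B where "finite B" "card B = H_apr \<omega> \<delta>"
    "\<And>x. x \<in> \<omega> \<Longrightarrow> \<exists>y\<in>V.span B. norm (x - y) < \<delta>"
proof -
  let ?P = "\<lambda>d. \<exists>E. V.subspace E \<and> (\<exists>B. finite B \<and> V.span B = E) \<and> V.dim E = d \<and>
     (\<forall>x\<in>\<omega>. \<exists>y\<in>E. norm (x - y) < \<delta>)"
  \<comment> \<open>The span of the finite set itself is admissible, each point being its own
    approximant, so \<open>LEAST\<close> is attained.\<close>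
  have "?P (V.dim (V.span \<omega>))"
    using assms by (intro exI[of _ "V.span \<omega>"])
      (auto intro!: V.subspace_span bexI[OF _ V.span_base])
  then have "?P (H_apr \<omega> \<delta>)"
    unfolding H_apr_def by (rule LeastI)
  then obtain B where B: "finite B" "V.dim (V.span B) = H_apr \<omega> \<delta>"
      "\<forall>x\<in>\<omega>. \<exists>y\<in>V.span B. norm (x - y) < \<delta>"
    by blast
  \<comment> \<open>Thinning the spanning set to a basis makes its cardinality equal to the
    dimension.\<close>
  obtain C where C: "C \<subseteq> B" "V.independent C" "B \<subseteq> V.span C"
    using V.maximal_independent_subset[of B] by blast
  have "V.span C = V.span B"
    using C V.span_mono[of C B] V.span_minimal[OF C(3)] by (simp add: subset_antisym)
  moreover have "finite C" using C(1) B(1) finite_subset by blast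
  moreover from C have "V.dim (V.span C) = card C"
    by (simp add: V.dim_eq_card_independent)
  ultimately show thesis
    using B that[of C] by simp
qed

text \<open>The union of optimal spanning sets for the two parts serves both of them.\<close>

lemma H_apr_Un:
  assumes "finite \<omega>" "finite \<omega>'" "0 < \<delta>"
  shows "H_apr (\<omega> \<union> \<omega>') \<delta> \<le> H_apr \<omega> \<delta> + H_apr \<omega>' \<delta>"
proof -
  obtain B where B: "finite B" "card B = H_apr \<omega> \<delta>"
      "\<And>x. x \<in> \<omega> \<Longrightarrow> \<exists>y\<in>V.span B. norm (x - y) < \<delta>"
    using H_apr_witness[OF assms(1,3)] by blast
  obtain B' where B': "finite B'" "card B' = H_apr \<omega>' \<delta>"
      "\<And>x. x \<in> \<omega>' \<Longrightarrow> \<exists>y\<in>V.span B'. norm (x - y) < \<delta>"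
    using H_apr_witness[OF assms(2,3)] by blast
  have "V.span B \<subseteq> V.span (B \<union> B')" "V.span B' \<subseteq> V.span (B \<union> B')"
    by (auto intro!: V.span_mono)
  then have "H_apr (\<omega> \<union> \<omega>') \<delta> \<le> card (B \<union> B')"
    using B B' by (intro H_apr_le) blast+
  also have "\<dots> \<le> card B + card B'" by (rule card_Un_le)
  finally show ?thesis using B B' by simp
qed

section \<open>Unitary operators and existence of the entropy limit\<close>

lemma unitary_op_norm:
  assumes "unitary_op T"
  shows "norm (T x) = norm x"
proof -
  have "(of_real ((norm (T x))\<^sup>2) :: 'k) = of_real ((norm x)\<^sup>2)"
    using assms by (simp only: flip: ip_self) (simp add: unitary_op_def)
  then show ?thesis by (simp only: of_real_eq_iff) simp
qed

lemma unitary_op_funpow: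
  assumes "unitary_op T"
  shows "unitary_op (T ^^ k)"
proof (induction k)
  case 0
  show ?case
    using V.linear_id by (simp add: unitary_op_def id_def)
next
  case (Suc k)
  then show ?case
    using assms Vector_Spaces.linear_compose[of scale scale "T ^^ k" scale T] comp_surj[of "T ^^ k" T]
    unfolding unitary_op_def funpow.simps by simp
qed

text \<open>A linear isometry carries an approximating subspace to one for the image, with the same
  errors and no larger dimension.\<close>

lemma H_apr_image_le:
  assumes "unitary_op T" "finite \<omega>" "0 < \<delta>"
  shows "H_apr (T ` \<omega>) \<delta> \<le> H_apr \<omega> \<delta>"
proof -
  interpret T: Vector_Spaces.linear scale scale T
    using assms(1) by (simp add: unitary_op_def)
  obtain B where B: "finite B" "card B = H_apr \<omega> \<delta>"
      "\<And>x. x \<in> \<omega> \<Longrightarrow> \<exists>y\<in>V.span B. norm (x - y) < \<delta>"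
    using H_apr_witness[OF assms(2,3)] by blast
  have "H_apr (T ` \<omega>) \<delta> \<le> card (T ` B)"
  proof (rule H_apr_le)
    fix z assume "z \<in> T ` \<omega>"
    then obtain x y where "z = T x" "y \<in> V.span B" "norm (x - y) < \<delta>"
      using B(3) by blast
    then show "\<exists>y\<in>V.span (T ` B). norm (z - y) < \<delta>"
      using unitary_op_norm[OF assms(1), of "x - y"]
      by (intro bexI[of _ "T y"]) (auto simp: T.diff T.span_image)
  qed (use B in simp)
  also have "\<dots> \<le> card B" using B by (intro card_image_le)
  finally show ?thesis using B by simp
qed

lemma H_apr_orbit_convergent:
  assumes "unitary_op T" "finite \<omega>" "0 < \<delta>"
  shows "convergent (\<lambda>n. real (H_apr (\<Union>k<n. (T ^^ k) ` \<omega>) \<delta>) / real n)"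
proof (rule fekete_nat)
  fix m n :: nat
  \<comment> \<open>An orbit segment of length \<open>m + n\<close> is one of length
    \<open>m\<close> together with the image under \<open>T ^^ m\<close> of one of length
    \<open>n\<close>; this yields subadditivity.\<close>
  have "{..<m + n} = {..<m} \<union> (\<lambda>k. m + k) ` {..<n}"
    using ivl_disj_un_two(3)[of 0 m "m + n"] by (simp add: lessThan_atLeast0 add.commute)
  then have "(\<Union>k<m + n. (T ^^ k) ` \<omega>)
      = (\<Union>k<m. (T ^^ k) ` \<omega>) \<union> (T ^^ m) ` (\<Union>k<n. (T ^^ k) ` \<omega>)"
    by (simp add: image_UN image_image UN_Un funpow_add)
  then have "H_apr (\<Union>k<m + n. (T ^^ k) ` \<omega>) \<delta>
      \<le> H_apr (\<Union>k<m. (T ^^ k) ` \<omega>) \<delta> + H_apr ((T ^^ m) ` (\<Union>k<n. (T ^^ k) ` \<omega>)) \<delta>"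
    using assms by (simp only:) (intro H_apr_Un, auto)
  also have "H_apr ((T ^^ m) ` (\<Union>k<n. (T ^^ k) ` \<omega>)) \<delta> \<le> H_apr (\<Union>k<n. (T ^^ k) ` \<omega>) \<delta>"
    using assms by (intro H_apr_image_le unitary_op_funpow) auto
  finally show "H_apr (\<Union>k<m + n. (T ^^ k) ` \<omega>) \<delta>
      \<le> H_apr (\<Union>k<m. (T ^^ k) ` \<omega>) \<delta> + H_apr (\<Union>k<n. (T ^^ k) ` \<omega>) \<delta>"
    by simp
qed

section \<open>Entropy of a countable Lebesgue component\<close>

lemma countable_lebesgue_orthonormal:
  assumes "countable_lebesgue_spectrum H\<^sub>0 T"
  obtains x :: "nat \<Rightarrow> 'a"
  where "\<And>i j k l. ip ((T ^^ k) (x i)) ((T ^^ l) (x j)) = (if i = j \<and> k = l then 1 else 0)"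
proof -
  define Z where "Z = cyclic_subspace H\<^sub>0 T"
  obtain x :: "nat \<Rightarrow> 'a" where
    ob: "\<And>n. orthonormal_basis_of (\<lambda>k::int. int_iter H\<^sub>0 T k (x n)) (Z (x n))"
    and ds: "hilbert_direct_sum H\<^sub>0 (\<lambda>n. Z (x n))"
    using assms unfolding countable_lebesgue_spectrum_def Z_def by blast
  \<comment> \<open>On nonnegative exponents the powers of the restriction are plain iterates of
    \<open>T\<close>, with no inverse involved.\<close>
  have it: "int_iter H\<^sub>0 T (int k) y = (T ^^ k) y" for k y
    by (simp add: int_iter_def)
  have mem: "(T ^^ k) (x i) \<in> Z (x i)" for k i
  proof -
    have "(T ^^ k) (x i) \<in> range (\<lambda>k::int. int_iter H\<^sub>0 T k (x i))"
      using it[of k "x i"] by (metis rangeI)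
    then show ?thesis
      unfolding Z_def cyclic_subspace_def by (intro subsetD[OF closure_subset] V.span_base)
  qed
  have "ip ((T ^^ k) (x i)) ((T ^^ l) (x j)) = (if i = j \<and> k = l then 1 else 0)" for i j k l
  \<comment> \<open>Within one cyclic subspace the orthonormal basis decides; distinct generators
    lie in orthogonal summands.\<close>
  proof (cases "i = j")
    case True
    have "ip (int_iter H\<^sub>0 T (int k) (x i)) (int_iter H\<^sub>0 T (int l) (x i))
        = (if int k = int l then 1 else 0)"
      using ob[of i] unfolding orthonormal_basis_of_def orthonormal_family_def by blast
    then show ?thesis using True by (simp add: it)
  next
    case False
    then show ?thesis
      using ds mem unfolding hilbert_direct_sum_def by auto
  qed
  then show thesis using that by blast
qed

lemma h_apr_ge:
  fixes x :: "nat \<Rightarrow> 'a"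
  assumes "unitary_op T"
    and on: "\<And>i j k l. ip ((T ^^ k) (x i)) ((T ^^ l) (x j)) = (if i = j \<and> k = l then 1 else 0)"
  shows "ereal (3 / 4 * real N) \<le> h_apr T"
proof -
  define \<omega> where "\<omega> = x ` {..<N}"
  \<comment> \<open>For \<delta> = 1/2 the factor 1 - \<delta>\<open>\<^sup>2\<close> is 3/4, a
    positive constant independent of \<open>N\<close>.\<close>
  define a where "a n = H_apr (\<Union>k<n. (T ^^ k) ` \<omega>) (1 / 2)" for n
  have fin: "finite \<omega>" by (simp add: \<omega>_def)
  have "3 / 4 * real N \<le> real (a n) / real n" if "n \<ge> 1" for n
  proof -
    define g where "g = (\<lambda>(k, i). (T ^^ k) (x i))"
    have A: "(\<Union>k<n. (T ^^ k) ` \<omega>) = g ` ({..<n} \<times> {..<N})"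
      unfolding g_def \<omega>_def by auto
    have ipg: "ip (g p) (g q) = (if p = q then 1 else 0)" for p q
      using on by (auto simp: g_def split: prod.split)
    \<comment> \<open>Orthonormality separates the iterates, so the orbit segment has exactly
      \<open>n * N\<close> points.\<close>
    then have "inj g" by (metis injI zero_neq_one)
    then have card: "card (g ` ({..<n} \<times> {..<N})) = n * N"
      by (subst card_image) (auto simp: card_cartesian_product intro: inj_on_subset)
    have os: "orthonormal_set (g ` ({..<n} \<times> {..<N}))"
      using \<open>inj g\<close> by (auto simp: orthonormal_set_def ipg inj_eq)
    obtain B where B: "finite B" "card B = a n"
        "\<And>z. z \<in> g ` ({..<n} \<times> {..<N}) \<Longrightarrow> \<exists>y\<in>V.span B. norm (z - y) < 1 / 2"
      using H_apr_witness[of "g ` ({..<n} \<times> {..<N})" "1 / 2"] unfolding a_def A by auto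
    have "(1 - (1 / 2)\<^sup>2) * real (n * N) \<le> real (a n)"
      using card_orthonormal_approx[OF _ os B(1) _ B(3)] by (simp add: card B(2))
    then show ?thesis
      using that by (simp add: field_simps power2_eq_square)
  qed
  \<comment> \<open>By convergence \<open>lim\<close> is a genuine limit and inherits the bound
    valid for all \<open>n \<ge> 1\<close>.\<close>
  moreover have "(\<lambda>n. real (a n) / real n) \<longlonglongrightarrow> h_apr_delta T \<omega> (1 / 2)"
    unfolding h_apr_delta_def a_def
    using H_apr_orbit_convergent[OF assms(1) fin, of "1 / 2"] by (simp add: convergent_LIMSEQ_iff)
  ultimately have "3 / 4 * real N \<le> h_apr_delta T \<omega> (1 / 2)"
    by (intro LIMSEQ_le_const) blast+
  then have "ereal (3 / 4 * real N) \<le> ereal (h_apr_delta T \<omega> (1 / 2))" by simp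
  also have "\<dots> \<le> h_apr_set T \<omega>"
    unfolding h_apr_set_def by (intro SUP_upper) auto
  also have "\<dots> \<le> h_apr T"
    unfolding h_apr_def using fin by (intro SUP_upper) auto
  finally show ?thesis .
qed

end

theorem proposition4p4:
  fixes scale :: "'k::real_or_complex_field \<Rightarrow> 'a::banach \<Rightarrow> 'a"
    and ip :: "'a \<Rightarrow> 'a \<Rightarrow> 'k"
    and T :: "'a \<Rightarrow> 'a"
  assumes "hilbert_space scale ip"
    and "hilbert_space.unitary_op scale ip T"
    and "hilbert_space.has_countable_lebesgue_component scale ip T"
  shows "hilbert_space.h_apr scale T = \<infinity>"
proof -
  interpret hilbert_space scale ip by fact
  obtain H\<^sub>0 where "countable_lebesgue_spectrum H\<^sub>0 T"
    using assms(3) unfolding has_countable_lebesgue_component_def by blast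
  then obtain x :: "nat \<Rightarrow> 'a" where
    "\<And>i j k l. ip ((T ^^ k) (x i)) ((T ^^ l) (x j)) = (if i = j \<and> k = l then 1 else 0)"
    by (rule countable_lebesgue_orthonormal) blast
  then have ge: "ereal (3 / 4 * real N) \<le> h_apr T" for N
    using h_apr_ge assms(2) by blast
  show ?thesis
  proof (rule ereal_top)
    fix B :: real
    \<comment> \<open>\<open>N\<close> is chosen so that 3/4 of it exceeds the prescribed real
      bound.\<close>
    obtain N where "4 / 3 * B < real N" using reals_Archimedean2 by blast
    then have "ereal B \<le> ereal (3 / 4 * real N)" by simp
    then show "ereal B \<le> h_apr T" using ge order_trans by blast
  qed
qed

end
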